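(* Let $d,N\ge 1$ be integers and let $\kappa=(\nu,P,\tilde P,U)\in\mathcal K_d$ (see context). Let $m=(m_1,\dots,m_d)\in\mathbb N_0^d$ and $\tilde m=(\tilde m_1,\dots,\tilde m_d)\in\mathbb N_0^d$ with $|m|\le N$ and $|\tilde m|\le N$, and let $v_1,\dots,v_d$ be the standard basis of $\mathbb C^d$. Then for every $i\in\{1,2,\dots,d\}$, $$\begin{aligned}\left(m_i-\frac{N}{d+1}\right)\mathcal P(m,\tilde m)={}&\sum_{l=1}^d\tilde p_iu_{l,i}\tilde m_l\,\mathcal P(m,\tilde m-v_l)+\nu\sum_{k=1}^d\tilde p_ip_ku_{k,i}(N-|\tilde m|)\,\mathcal P(m,\tilde m+v_k)\\&+\sum_{j=1}^d\tilde p_i(\nu p_ju_{j,i}^2-1)\left(\tilde m_j-\frac{N}{d+1}\right)\mathcal P(m,\tilde m)\\&+\nu\sum_{1\le k\ne l\le d}\tilde p_ip_ku_{k,i}u_{l,i}\tilde m_l\,\mathcal P(m,\tilde m+v_k-v_l),\end{aligned}$$ and $$\begin{aligned}\left(\tilde m_i-\frac{N}{d+1}\right)\mathcal P(m,\tilde m)={}&\sum_{l=1}^dp_iu_{i,l}m_l\,\mathcal P(m-v_l,\tilde m)+\nu\sum_{k=1}^dp_i\tilde p_ku_{i,k}(N-|m|)\,\mathcal P(m+v_k,\tilde m)\\&+\sum_{j=1}^dp_i(\nu\tilde p_ju_{i,j}^2-1)\left(m_j-\frac{N}{d+1}\right)\mathcal P(m,\tilde m)\\&+\nu\sum_{1\le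 k\ne l\le d}p_i\tilde p_ku_{i,k}u_{i,l}m_l\,\mathcal P(m+v_k-v_l,\tilde m).\end{aligned}$$
   Context: $\mathcal K_d$ is the set of 4-tuples $(\nu,P,\tilde P,U)$ where $\nu$ is a nonzero complex number and $P,\tilde P,U$ are $(d+1)\times(d+1)$ complex matrices (rows and columns indexed by $0,\dots,d$) such that: (i) $P=\mathrm{diag}(p_0,\dots,p_d)$ and $\tilde P=\mathrm{diag}(\tilde p_0,\dots,\tilde p_d)$ with $p_0=\tilde p_0=1/\nu$; (ii) $U=(u_{i,j})_{0\le i,j\le d}$ with $u_{0,j}=u_{j,0}=1$ for all $j=0,\dots,d$; (iii) $\nu PU\tilde PU^t=I_{d+1}$. For $m\in\mathbb N_0^d$, $|m|=m_1+\cdots+m_d$. The multivariate Krawtchouk polynomials are defined by $$\mathcal P(m,\tilde m)=\sum_{A=(a_{i,j})\in\mathcal M_{d,N}}\frac{\prod_{j=1}^d(-m_j)_{\sum_{i=1}^da_{i,j}}\prod_{i=1}^d(-\tilde m_i)_{\sum_{j=1}^da_{i,j}}}{(-N)_{\sum_{i,j=1}^da_{i,j}}}\prod_{i,j=1}^d\frac{\omega_{i,j}^{a_{i,j}}}{a_{i,j}!},$$ where $\omega_{i,j}=1-u_{i,j}$, $\mathcal M_{d,N}$ is the set of $d\times d$ matrices with nonnegative integer entries whose sum is at most $N$, and $(a)_k=a(a+1)\cdots(a+k-1)$, $(a)_0=1$. Whenever a shifted argument such as $\tilde m-v_l$ or $\tilde m+v_k$ leaves the set $\{\mu\in\mathbb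 N_0^d:|\mu|\le N\}$, the corresponding term has coefficient $0$ (a factor $\tilde m_l=0$, $m_l=0$, $N-|\tilde m|=0$ or $N-|m|=0$) and is read as $0$. *)

theory Defs
  imports Complex_Main "Jordan_Normal_Form.Matrix"
begin

text \<open>Matrix entries are numbered from \<^term>\<open>0::nat\<close> on in \<^typ>\<open>complex mat\<close>, so a matrix in
  \<open>carrier_mat (d + 1) (d + 1)\<close> has rows and columns indexed by \<open>0, \<dots>, d\<close>.
  The diagonal entries are \<open>p\<^sub>j = P $$ (j, j)\<close>.\<close>

definition kappa_set :: "nat \<Rightarrow> (complex \<times> complex mat \<times> complex mat \<times> complex mat) set" where
  "kappa_set d = {(\<nu>, P, Pt, U).
     \<nu> \<noteq> 0 \<and>
     P \<in> carrier_mat (d + 1) (d + 1) \<and>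
     Pt \<in> carrier_mat (d + 1) (d + 1) \<and>
     U \<in> carrier_mat (d + 1) (d + 1) \<and>
     diagonal_mat P \<and> diagonal_mat Pt \<and>
     P $$ (0, 0) = 1 / \<nu> \<and> Pt $$ (0, 0) = 1 / \<nu> \<and>
     (\<forall>j\<le>d. U $$ (0, j) = 1 \<and> U $$ (j, 0) = 1) \<and>
     \<nu> \<cdot>\<^sub>m (P * U * Pt * transpose_mat U) = 1\<^sub>m (d + 1)}"

text \<open>Multi-indices \<open>m = (m\<^sub>1, \<dots>, m\<^sub>d)\<close> are functions \<^typ>\<open>nat \<Rightarrow> nat\<close> of which only the values at
  \<open>1, \<dots>, d\<close> are ever used.\<close>

definition mi_size :: "nat \<Rightarrow> (nat \<Rightarrow> nat) \<Rightarrow> nat" where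
  "mi_size d m = (\<Sum>j = 1..d. m j)"

definition mi_unit :: "nat \<Rightarrow> nat \<Rightarrow> nat" where
  "mi_unit k = (\<lambda>j. if j = k then 1 else 0)"

definition mi_add :: "(nat \<Rightarrow> nat) \<Rightarrow> (nat \<Rightarrow> nat) \<Rightarrow> nat \<Rightarrow> nat" where
  "mi_add m n = (\<lambda>j. m j + n j)"

text \<open>Subtraction is truncated. When \<open>m l = 0\<close> the multi-index \<open>m - v\<^sub>l\<close> is therefore a junk value;
  a term evaluated there has to carry the factor \<open>m l\<close>.\<close>

definition mi_sub :: "(nat \<Rightarrow> nat) \<Rightarrow> (nat \<Rightarrow> nat) \<Rightarrow> nat \<Rightarrow> nat" where
  "mi_sub m n = (\<lambda>j. m j - n j)"

text \<open>A \<open>d \<times> d\<close> matrix of naturals with indices in \<open>1, \<dots>, d\<close> is encoded as a function that is zero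
  elsewhere, so that every matrix has exactly one representative and the set below is finite.\<close>

definition nat_matrices :: "nat \<Rightarrow> nat \<Rightarrow> (nat \<Rightarrow> nat \<Rightarrow> nat) set" where
  "nat_matrices d N = {a.
     (\<forall>i j. i \<notin> {1..d} \<or> j \<notin> {1..d} \<longrightarrow> a i j = 0) \<and>
     (\<Sum>i = 1..d. \<Sum>j = 1..d. a i j) \<le> N}"

definition krawtchouk ::
  "nat \<Rightarrow> nat \<Rightarrow> complex mat \<Rightarrow> (nat \<Rightarrow> nat) \<Rightarrow> (nat \<Rightarrow> nat) \<Rightarrow> complex" where
  "krawtchouk d N U m mt =
    (\<Sum>a\<in>nat_matrices d N.
       (\<Prod>j = 1..d. pochhammer (- of_nat (m j)) (\<Sum>i = 1..d. a i j)) *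
       (\<Prod>i = 1..d. pochhammer (- of_nat (mt i)) (\<Sum>j = 1..d. a i j)) /
       pochhammer (- of_nat N) (\<Sum>i = 1..d. \<Sum>j = 1..d. a i j) *
       (\<Prod>i = 1..d. \<Prod>j = 1..d. (1 - U $$ (i, j)) ^ a i j / fact (a i j)))"

end

(*
  With m_0 = N - |m| the multi-indices become compositions of N with entries 0, ..., d, and the
  first identity collapses to
    m_i P_N(m, mt) = sum over k, l in 0..d of V_ik u_li mt_l P_N(m, mt + v_k - v_l),
  where V_ik = nu pt_i p_k u_ki are the entries of the inverse of U. Comparing coefficients in the
  defining sum gives N P_N(m, mt) = sum over l of mt_l u_li P_(N-1)(m - v_i, mt - v_l) whenever
  m_i > 0. Applying the transposed form of this recursion to P_N(m, mt + v_k - v_l) at the index k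
  turns the sum over k into V U = I, and the recursion itself sums what is left over l. The second
  identity is the first one for the transposed data (nu, Pt, P, U^t).
*)
theory Submission
  imports Defs "Jordan_Normal_Form.Determinant"
begin

section \<open>Pochhammer products at shifted multi-indices\<close>

text \<open>Up to sign both sides are (-n)_(r+1), with either the first or the last factor split
  off. For n = 0 the truncated n - 1 does no harm, since both sides vanish.\<close>

lemma pochhammer_minus_pred:
  fixes n r :: nat
  shows "of_nat n * pochhammer (- of_nat (n - 1)) r
    = (of_nat n - of_nat r) * (pochhammer (- of_nat n) r :: 'a :: comm_ring_1)"
proof (cases n)
  case 0
  then show ?thesis by (cases r) (auto simp: pochhammer_rec)
next
  case (Suc k)
  have "(- of_nat n) * pochhammer (- of_nat n + 1) r = pochhammer (- of_nat n :: 'a) (Suc r)"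
    by (rule pochhammer_rec[symmetric])
  also have "\<dots> = pochhammer (- of_nat n) r * (- of_nat n + of_nat r)"
    by (rule pochhammer_Suc)
  also have "- of_nat n + 1 = (- of_nat (n - 1) :: 'a)" using Suc by simp
  finally have "- (of_nat n * pochhammer (- of_nat (n - 1)) r)
      = - ((of_nat n - of_nat r) * (pochhammer (- of_nat n) r :: 'a))"
    by (simp add: algebra_simps)
  then show ?thesis by (simp only: neg_equal_iff_equal)
qed

lemma pochhammer_minus_Suc:
  fixes n r :: nat
  shows "pochhammer (- of_nat n) (Suc r)
    = - of_nat n * (pochhammer (- of_nat (n - 1)) r :: 'a :: comm_ring_1)"
  by (cases n) (auto simp: pochhammer_rec)

lemma prod_pochhammer_sub_unit:
  assumes "l \<in> {1..d}"
  shows "of_nat (m l) * (\<Prod>j = 1..d. pochhammer (- of_nat (mi_sub m (mi_unit l) j)) (r j))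
    = (of_nat (m l) - of_nat (r l))
      * (\<Prod>j = 1..d. pochhammer (- of_nat (m j)) (r j) :: 'a :: comm_ring_1)"
proof -
  let ?R = "\<Prod>j\<in>{1..d} - {l}. pochhammer (- of_nat (m j)) (r j) :: 'a"
  have "(\<Prod>j = 1..d. pochhammer (- of_nat (mi_sub m (mi_unit l) j)) (r j) :: 'a)
    = pochhammer (- of_nat (m l - 1)) (r l) * ?R"
    using assms by (subst prod.remove[of _ l]) (auto simp: mi_sub_def mi_unit_def intro!: prod.cong)
  moreover have "(\<Prod>j = 1..d. pochhammer (- of_nat (m j)) (r j) :: 'a)
    = pochhammer (- of_nat (m l)) (r l) * ?R"
    using assms by (subst prod.remove[of _ l]) auto
  ultimately show ?thesis
    using pochhammer_minus_pred[of "m l" "r l", where 'a = 'a] by (simp add: mult.assoc[symmetric])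
qed

lemma prod_pochhammer_add_unit:
  assumes "l \<in> {1..d}"
  shows "(\<Prod>j = 1..d. pochhammer (- of_nat (m j)) (mi_add r (mi_unit l) j))
    = - of_nat (m l)
      * (\<Prod>j = 1..d. pochhammer (- of_nat (mi_sub m (mi_unit l) j)) (r j) :: 'a :: comm_ring_1)"
proof -
  let ?R = "\<Prod>j\<in>{1..d} - {l}. pochhammer (- of_nat (m j)) (r j) :: 'a"
  have "(\<Prod>j = 1..d. pochhammer (- of_nat (mi_sub m (mi_unit l) j)) (r j) :: 'a)
    = pochhammer (- of_nat (m l - 1)) (r l) * ?R"
    using assms by (subst prod.remove[of _ l]) (auto simp: mi_sub_def mi_unit_def intro!: prod.cong)
  moreover have "(\<Prod>j = 1..d. pochhammer (- of_nat (m j)) (mi_add r (mi_unit l) j) :: 'a)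
    = pochhammer (- of_nat (m l)) (Suc (r l)) * ?R"
    using assms by (subst prod.remove[of _ l]) (auto simp: mi_add_def mi_unit_def intro!: prod.cong)
  ultimately show ?thesis
    by (simp add: pochhammer_minus_Suc mult.assoc)
qed

text \<open>Entry 0 of m does not occur in the products, so l = 0 contributes the unshifted product
  with weight m_0, while every l > 0 contributes it with weight m_l - r_l. Only the totals of m and
  r survive, which is the point of the extra entry m_0.\<close>

lemma sum_prod_pochhammer_sub_unit:
  fixes m r :: "nat \<Rightarrow> nat"
  shows "(\<Sum>l = 0..d. of_nat (m l)
      * (\<Prod>j = 1..d. pochhammer (- of_nat (mi_sub m (mi_unit l) j)) (r j)))
    = (of_nat (\<Sum>l = 0..d. m l) - of_nat (\<Sum>l = 1..d. r l))
      * (\<Prod>j = 1..d. pochhammer (- of_nat (m j)) (r j) :: 'a :: comm_ring_1)"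
    (is "?L = _ * ?Q")
proof -
  have 0: "(\<Prod>j = 1..d. pochhammer (- of_nat (mi_sub m (mi_unit 0) j)) (r j)) = ?Q"
    by (intro prod.cong) (auto simp: mi_sub_def mi_unit_def)
  have "?L = of_nat (m 0) * ?Q + (\<Sum>l = 1..d. (of_nat (m l) - of_nat (r l)) * ?Q)"
    by (subst sum.atLeast_Suc_atMost)
      (simp_all only: 0 One_nat_def[symmetric] prod_pochhammer_sub_unit le0 cong: sum.cong)
  also have "\<dots> = (of_nat (m 0) + (\<Sum>l = 1..d. of_nat (m l)) - (\<Sum>l = 1..d. of_nat (r l))) * ?Q"
    by (simp add: sum_distrib_right[symmetric] sum_subtractf algebra_simps)
  finally show ?thesis
    by (simp add: sum.atLeast_Suc_atMost[of 0 d])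
qed

section \<open>Summands of the Krawtchouk polynomial and its symmetry\<close>

text \<open>Separating the summand from the range of the sum lets terms with parameters N and N + 1
  be compared at one and the same matrix.\<close>

definition krawtchouk_term ::
  "nat \<Rightarrow> nat \<Rightarrow> complex mat \<Rightarrow> (nat \<Rightarrow> nat) \<Rightarrow> (nat \<Rightarrow> nat) \<Rightarrow> (nat \<Rightarrow> nat \<Rightarrow> nat) \<Rightarrow> complex" where
  "krawtchouk_term d N U m mt a =
     (\<Prod>j = 1..d. pochhammer (- of_nat (m j)) (\<Sum>i = 1..d. a i j)) *
     (\<Prod>i = 1..d. pochhammer (- of_nat (mt i)) (\<Sum>j = 1..d. a i j)) /
     pochhammer (- of_nat N) (\<Sum>i = 1..d. \<Sum>j = 1..d. a i j) *
     (\<Prod>i = 1..d. \<Prod>j = 1..d. (1 - U $$ (i, j)) ^ a i j / fact (a i j))"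

lemma krawtchouk_eq_sum_term:
  "krawtchouk d N U m mt = (\<Sum>a\<in>nat_matrices d N. krawtchouk_term d N U m mt a)"
  by (simp add: krawtchouk_def krawtchouk_term_def)

text \<open>Entry 0 of a multi-index is invisible to \<open>krawtchouk\<close>; it is therefore free
  to hold the slack N - |m|, and shifts by v_0 change nothing.\<close>

lemma krawtchouk_cong:
  assumes "\<And>j. j \<in> {1..d} \<Longrightarrow> m j = m' j" "\<And>j. j \<in> {1..d} \<Longrightarrow> mt j = mt' j"
  shows "krawtchouk d N U m mt = krawtchouk d N U m' mt'"
proof -
  have "(\<Prod>j = 1..d. pochhammer (- of_nat (m j)) (r j))
      = (\<Prod>j = 1..d. pochhammer (- of_nat (m' j)) (r j) :: complex)"
    and "(\<Prod>j = 1..d. pochhammer (- of_nat (mt j)) (r j))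
      = (\<Prod>j = 1..d. pochhammer (- of_nat (mt' j)) (r j) :: complex)"
    for r
    using assms by (auto intro!: prod.cong)
  then show ?thesis
    unfolding krawtchouk_def by (simp only:)
qed

text \<open>Transposing the summation matrix exchanges row sums and column sums. This turns every
  result about shifts of one argument into one about the other argument.\<close>

lemma krawtchouk_transpose:
  assumes "U \<in> carrier_mat (d + 1) (d + 1)"
  shows "krawtchouk d N (transpose_mat U) mt m = krawtchouk d N U m mt"
  unfolding krawtchouk_eq_sum_term
proof (rule sum.reindex_bij_witness[of _ "\<lambda>a i j. a j i" "\<lambda>a i j. a j i"], goal_cases)
  case (2 a)
  then show ?case
    by (auto simp: nat_matrices_def) (metis sum.swap)
next
  case (4 a)
  then show ?case
    by (auto simp: nat_matrices_def) (metis sum.swap)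
next
  case (5 a)
  have "(\<Prod>i = 1..d. \<Prod>j = 1..d. (1 - transpose_mat U $$ (i, j)) ^ a i j / fact (a i j) :: complex)
     = (\<Prod>i = 1..d. \<Prod>j = 1..d. (1 - U $$ (j, i)) ^ a i j / fact (a i j))"
    using assms by (intro prod.cong) auto
  also have "\<dots> = (\<Prod>j = 1..d. \<Prod>i = 1..d. (1 - U $$ (j, i)) ^ a i j / fact (a i j))"
    by (rule prod.swap)
  finally show ?case
    unfolding krawtchouk_term_def
    by (simp add: mult.commute mult.left_commute sum.swap[of "\<lambda>i j. a j i"])
qed auto

lemma finite_nat_matrices: "finite (nat_matrices d N)"
proof -
  let ?F = "{f :: nat \<times> nat \<Rightarrow> nat. \<forall>x. (x \<in> {1..d} \<times> {1..d} \<longrightarrow> f x \<in> {..N})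
    \<and> (x \<notin> {1..d} \<times> {1..d} \<longrightarrow> f x = 0)}"
  have "a i j \<le> N" if a: "a \<in> nat_matrices d N" and ij: "i \<in> {1..d}" "j \<in> {1..d}" for a i j
  proof -
    have "a i j \<le> (\<Sum>j = 1..d. a i j)" using ij by (intro member_le_sum) auto
    also have "\<dots> \<le> (\<Sum>i = 1..d. \<Sum>j = 1..d. a i j)"
      using ij by (intro member_le_sum[of i _ "\<lambda>i. \<Sum>j = 1..d. a i j"]) auto
    also have "\<dots> \<le> N" using a by (simp add: nat_matrices_def)
    finally show ?thesis .
  qed
  then have "(\<lambda>a. case_prod a) ` nat_matrices d N \<subseteq> ?F"
    by (auto simp: nat_matrices_def)
  moreover have "finite ?F"
    by (rule finite_set_of_finite_funs) auto
  ultimately have "finite (case_prod ` nat_matrices d N)"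
    by (rule finite_subset)
  then show ?thesis
    by (rule finite_imageD) (auto simp: inj_on_def fun_eq_iff)
qed

section \<open>Effect of lowering a multi-index on a single term\<close>

text \<open>Only the row product depends on l, and its weighted sum produces the factor N + 1 - s,
  where s is the total of a. This is exactly what converts the denominator (-N)_s into
  (-(N+1))_s.\<close>

lemma sum_krawtchouk_term_lower:
  assumes mt: "(\<Sum>l = 0..d. mt l) = Suc N" and a: "a \<in> nat_matrices d N"
  shows "(\<Sum>l = 0..d. of_nat (mt l) * krawtchouk_term d N U m (mi_sub mt (mi_unit l)) a)
    = of_nat (Suc N) * krawtchouk_term d (Suc N) U m mt a"
proof -
  let ?s = "\<Sum>i = 1..d. \<Sum>j = 1..d. a i j"
  let ?W = "\<Prod>i = 1..d. \<Prod>j = 1..d. (1 - U $$ (i, j)) ^ a i j / fact (a i j)"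
  let ?X = "\<Prod>j = 1..d. pochhammer (- of_nat (m j)) (\<Sum>i = 1..d. a i j) :: complex"
  let ?Y = "\<lambda>mt. \<Prod>i = 1..d. pochhammer (- of_nat (mt i)) (\<Sum>j = 1..d. a i j) :: complex"
  let ?p = "pochhammer (- of_nat N) ?s :: complex"
  let ?q = "pochhammer (- of_nat (Suc N)) ?s :: complex"
  have s: "?s \<le> N" using a by (simp add: nat_matrices_def)
  \<comment> \<open>(-N)_s is nonzero precisely because s does not exceed N; this is where
    membership in the smaller set of matrices enters.\<close>
  have nz: "?p \<noteq> 0" "?q \<noteq> 0" using s by (auto simp: pochhammer_of_nat_eq_0_iff simp del: of_nat_Suc)
  have pq: "of_nat (Suc N) * ?p = (of_nat (Suc N) - of_nat ?s) * ?q"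
    using pochhammer_minus_pred[of "Suc N" ?s, where 'a = complex] by simp
  have "(\<Sum>l = 0..d. of_nat (mt l) * krawtchouk_term d N U m (mi_sub mt (mi_unit l)) a)
      = ?X * (\<Sum>l = 0..d. of_nat (mt l) * ?Y (mi_sub mt (mi_unit l))) / ?p * ?W"
    by (simp add: krawtchouk_term_def sum_distrib_left sum_distrib_right sum_divide_distrib mult_ac)
  also have "\<dots> = ?X * ((of_nat (Suc N) - of_nat ?s) * ?Y mt) / ?p * ?W"
    by (simp only: sum_prod_pochhammer_sub_unit mt)
  also have "\<dots> = ?X * ?Y mt * ?W * ((of_nat (Suc N) - of_nat ?s) / ?p)"
    by simp
  also have "(of_nat (Suc N) - of_nat ?s) / ?p = of_nat (Suc N) / ?q"
    using nz pq by (simp add: frac_eq_eq del: of_nat_Suc)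
  finally show ?thesis
    by (simp add: krawtchouk_term_def del: of_nat_Suc)
qed

lemma krawtchouk_term_sub_unit:
  assumes "i \<in> {1..d}"
  shows "of_nat (m i) * krawtchouk_term d N U (mi_sub m (mi_unit i)) mt a
    = (of_nat (m i) - of_nat (\<Sum>l = 1..d. a l i)) * krawtchouk_term d N U m mt a"
  using prod_pochhammer_sub_unit[OF assms, of m "\<lambda>j. \<Sum>i = 1..d. a i j", where 'a = complex]
  unfolding krawtchouk_term_def by (simp add: mult.assoc[symmetric] times_divide_eq_right)

text \<open>Such a matrix has total exactly N + 1. A nonzero term would need every column sum to be
  at most m_j, and comparing totals then forces m_0 = 0 and equality in every column. The lemma
  disposes of the matrices by which the ranges for N + 1 and N differ.\<close>

lemma krawtchouk_term_eq_0:
  assumes m: "(\<Sum>j = 0..d. m j) = Suc N"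
    and a: "a \<in> nat_matrices d (Suc N) - nat_matrices d N"
    and i: "m 0 > 0 \<or> i \<in> {1..d} \<and> m i \<noteq> (\<Sum>l = 1..d. a l i)"
  shows "krawtchouk_term d (Suc N) U m mt a = 0"
proof -
  let ?c = "\<lambda>j. \<Sum>i = 1..d. a i j"
  have "(\<Sum>i = 1..d. \<Sum>j = 1..d. a i j) = Suc N"
    using a by (auto simp: nat_matrices_def)
  then have c: "(\<Sum>j = 1..d. ?c j) = Suc N" by (metis sum.swap)
  have m': "m 0 + (\<Sum>j = 1..d. m j) = Suc N"
    using m by (simp add: sum.atLeast_Suc_atMost[of 0 d])
  have "\<exists>j\<in>{1..d}. m j < ?c j"
  proof (rule ccontr)
    assume "\<not> ?thesis"
    then have le: "\<And>j. j \<in> {1..d} \<Longrightarrow> ?c j \<le> m j" by force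
    then have "(\<Sum>j = 1..d. ?c j) \<le> (\<Sum>j = 1..d. m j)" by (rule sum_mono)
    with c m' have 0: "m 0 = 0" and eq: "(\<Sum>j = 1..d. ?c j) = (\<Sum>j = 1..d. m j)" by auto
    with i have i': "i \<in> {1..d}" "?c i < m i" using le[of i] by auto
    have "(\<Sum>j = 1..d. ?c j) < (\<Sum>j = 1..d. m j)"
      using le i' by (intro sum_strict_mono_ex1) auto
    with eq show False by simp
  qed
  then have "(\<Prod>j = 1..d. pochhammer (- of_nat (m j)) (?c j) :: complex) = 0"
    by (auto simp: pochhammer_of_nat_eq_0_iff)
  then show ?thesis by (simp add: krawtchouk_term_def)
qed

section \<open>Raising one entry of the summation matrix\<close>

definition add_entry :: "nat \<Rightarrow> nat \<Rightarrow> (nat \<Rightarrow> nat \<Rightarrow> nat) \<Rightarrow> nat \<Rightarrow> nat \<Rightarrow> nat" where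
  "add_entry l i a = a(l := mi_add (a l) (mi_unit i))"

lemma add_entry_apply: "add_entry l i a k j = a k j + (if k = l \<and> j = i then 1 else 0)"
  by (auto simp: add_entry_def mi_add_def mi_unit_def)

text \<open>The row and column sums are phrased with \<open>mi_add\<close> and
  \<open>mi_unit\<close> so that \<open>prod_pochhammer_add_unit\<close> applies to them
  directly.\<close>

lemma add_entry_sums:
  assumes "l \<in> {1..d}" "i \<in> {1..d}"
  shows "(\<Sum>j = 1..d. add_entry l i a k j) = mi_add (\<lambda>k. \<Sum>j = 1..d. a k j) (mi_unit l) k"
    and "(\<Sum>k = 1..d. add_entry l i a k j) = mi_add (\<lambda>j. \<Sum>k = 1..d. a k j) (mi_unit i) j"
    and "(\<Sum>k = 1..d. \<Sum>j = 1..d. add_entry l i a k j) = Suc (\<Sum>k = 1..d. \<Sum>j = 1..d. a k j)"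
proof -
  show 1: "(\<Sum>j = 1..d. add_entry l i a k j) = mi_add (\<lambda>k. \<Sum>j = 1..d. a k j) (mi_unit l) k" for k
    using assms by (auto simp: add_entry_apply sum.distrib mi_add_def mi_unit_def)
  show "(\<Sum>k = 1..d. add_entry l i a k j) = mi_add (\<lambda>j. \<Sum>k = 1..d. a k j) (mi_unit i) j"
    using assms by (cases "j = i") (auto simp: add_entry_apply sum.distrib mi_add_def mi_unit_def)
  show "(\<Sum>k = 1..d. \<Sum>j = 1..d. add_entry l i a k j) = Suc (\<Sum>k = 1..d. \<Sum>j = 1..d. a k j)"
    using assms unfolding 1 by (simp add: mi_add_def mi_unit_def sum.distrib)
qed

text \<open>The raised column sum gives -m_i, the raised row sum gives -mt_l, and the denominator
  gives -(N+1), which leaves one minus sign. The entry itself cancels the new factor of its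
  factorial, and the weight gains one factor 1 - u_(l,i).\<close>

lemma krawtchouk_term_add_entry:
  assumes l: "l \<in> {1..d}" and i: "i \<in> {1..d}"
  shows "of_nat (Suc N)
      * (of_nat (add_entry l i a l i) * krawtchouk_term d (Suc N) U m mt (add_entry l i a))
    = - (of_nat (m i) * of_nat (mt l) * (1 - U $$ (l, i))
      * krawtchouk_term d N U (mi_sub m (mi_unit i)) (mi_sub mt (mi_unit l)) a)"
proof -
  let ?s = "\<Sum>i = 1..d. \<Sum>j = 1..d. a i j"
  let ?g = "\<lambda>a i j. (1 - U $$ (i, j)) ^ a i j / fact (a i j)"
  let ?W = "\<lambda>a :: nat \<Rightarrow> nat \<Rightarrow> nat. \<Prod>i = 1..d. \<Prod>j = 1..d. ?g a i j"
  let ?X = "\<Prod>j = 1..d. pochhammer (- of_nat (mi_sub m (mi_unit i) j)) (\<Sum>i = 1..d. a i j) :: complex"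
  let ?Y = "\<Prod>k = 1..d. pochhammer (- of_nat (mi_sub mt (mi_unit l) k)) (\<Sum>j = 1..d. a k j) :: complex"
  have W: "of_nat (Suc (a l i)) * ?W (add_entry l i a) = (1 - U $$ (l, i)) * ?W a"
  proof -
    let ?p = "(l, i)" and ?A = "{1..d} \<times> {1..d}"
    have p: "?p \<in> ?A" using l i by auto
    have eq: "?W b = ?g b l i * (\<Prod>(i, j)\<in>?A - {?p}. ?g b i j)" for b
      by (subst prod.cartesian_product, subst prod.remove[OF _ p]) auto
    have "(\<Prod>(r, s)\<in>?A - {?p}. ?g (add_entry l i a) r s) = (\<Prod>(r, s)\<in>?A - {?p}. ?g a r s)"
      by (rule prod.cong) (auto simp: add_entry_apply split: if_splits)
    then show ?thesis
      unfolding eq by (simp add: add_entry_apply fact_Suc del: of_nat_Suc)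
  qed
  have e: "add_entry l i a l i = Suc (a l i)" by (simp add: add_entry_apply)
  have q: "pochhammer (- of_nat (Suc N)) (Suc ?s) = - of_nat (Suc N) * (pochhammer (- of_nat N) ?s :: complex)"
    by (subst pochhammer_minus_Suc) simp
  have "of_nat (Suc N)
      * (of_nat (add_entry l i a l i) * krawtchouk_term d (Suc N) U m mt (add_entry l i a))
    = of_nat (Suc N) * ((of_nat (m i) * ?X) * (of_nat (mt l) * ?Y)
      / (- of_nat (Suc N) * pochhammer (- of_nat N) ?s)
      * (of_nat (Suc (a l i)) * ?W (add_entry l i a)))"
    \<comment> \<open>Rewriting the row sums also changes the inner sums of the total, so the fact
      about the total is first brought into that form.\<close>
    unfolding krawtchouk_term_def add_entry_sums(1,2)[OF l i]
      add_entry_sums(3)[OF l i, unfolded add_entry_sums(1)[OF l i]] prod_pochhammer_add_unit[OF l]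
      prod_pochhammer_add_unit[OF i] q e
    by (simp add: mult_ac del: of_nat_Suc)
  also have "\<dots> = - ((of_nat (m i) * ?X) * (of_nat (mt l) * ?Y)
      / (pochhammer (- of_nat N) ?s) * ((1 - U $$ (l, i)) * ?W a))"
    unfolding W using of_nat_neq_0[of N, where 'a = complex] by (simp del: of_nat_Suc)
  finally show ?thesis
    by (simp add: krawtchouk_term_def mult_ac)
qed

text \<open>The factor a_(l,i) removes the matrices whose entry there is 0; the remaining ones arise
  by raising that entry in a unique matrix of total at most N.\<close>

lemma sum_nat_matrices_add_entry:
  fixes f :: "(nat \<Rightarrow> nat \<Rightarrow> nat) \<Rightarrow> 'a :: comm_semiring_1"
  assumes l: "l \<in> {1..d}" and i: "i \<in> {1..d}"
  shows "(\<Sum>a\<in>nat_matrices d (Suc N). of_nat (a l i) * f a)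
    = (\<Sum>a\<in>nat_matrices d N. of_nat (add_entry l i a l i) * f (add_entry l i a))"
proof -
  let ?r = "\<lambda>a. a(l := mi_sub (a l) (mi_unit i))"
  have r: "add_entry l i (?r a) = a" if "a l i > 0" for a
    using that by (auto simp: fun_eq_iff add_entry_def mi_add_def mi_sub_def mi_unit_def)
  have "(\<Sum>a\<in>nat_matrices d (Suc N). of_nat (a l i) * f a)
    = (\<Sum>a | a \<in> nat_matrices d (Suc N) \<and> a l i > 0. of_nat (a l i) * f a)"
    by (rule sum.mono_neutral_right) (auto simp: finite_nat_matrices)
  also have "\<dots> = (\<Sum>a\<in>nat_matrices d N. of_nat (add_entry l i a l i) * f (add_entry l i a))"
  proof (rule sum.reindex_bij_witness[of _ "add_entry l i" ?r], goal_cases)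
    case (2 a)
    then have a: "add_entry l i (?r a) = a" by (intro r) simp
    have "(\<Sum>k = 1..d. \<Sum>j = 1..d. a k j) = Suc (\<Sum>k = 1..d. \<Sum>j = 1..d. ?r a k j)"
      using add_entry_sums(3)[OF l i, of "?r a"] unfolding a .
    with 2 show ?case by (auto simp: nat_matrices_def mi_sub_def)
  next
    case (3 a)
    then show ?case by (auto simp: fun_eq_iff add_entry_def mi_add_def mi_sub_def mi_unit_def)
  next
    case (4 a)
    then have "(\<Sum>k = 1..d. \<Sum>j = 1..d. add_entry l i a k j) \<le> Suc N"
      unfolding add_entry_sums(3)[OF l i] by (simp add: nat_matrices_def)
    with 4 l i show ?case by (auto simp: nat_matrices_def add_entry_apply)
  qed (simp_all add: r)
  finally show ?thesis .
qed

section \<open>Recursion from N + 1 to N\<close>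

text \<open>For i > 0 the factor m_i is split inside the sum as (m_i - c_i) + c_i, where c_i is the
  i-th column sum of a. The first part yields the right-hand side with weights 1, the second with
  weights -(1 - u_(l,i)); together they give u_(l,i), and m_i > 0 is cancelled. For i = 0 all
  u_(l,0) are 1 and no correction arises.\<close>

lemma krawtchouk_rec:
  assumes m: "(\<Sum>j = 0..d. m j) = Suc N" and mt: "(\<Sum>j = 0..d. mt j) = Suc N"
    and U: "\<forall>j\<le>d. U $$ (0, j) = 1 \<and> U $$ (j, 0) = 1"
    and i: "i \<le> d" and mi: "m i > 0"
  shows "of_nat (Suc N) * krawtchouk d (Suc N) U m mt
    = (\<Sum>l = 0..d. of_nat (mt l) * U $$ (l, i)
        * krawtchouk d N U (mi_sub m (mi_unit i)) (mi_sub mt (mi_unit l)))"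
proof -
  let ?M = "nat_matrices d N" and ?M' = "nat_matrices d (Suc N)"
  let ?T = "krawtchouk_term d (Suc N) U m mt"
  let ?K = "\<lambda>l. krawtchouk d N U (mi_sub m (mi_unit i)) (mi_sub mt (mi_unit l))"
  have sub: "?M \<subseteq> ?M'" by (auto simp: nat_matrices_def)
  \<comment> \<open>The sum on the right has parameter N + 1 but runs only over totals up to N. The
    first argument stays arbitrary because both m and m - v_i are needed.\<close>
  have shift: "(\<Sum>l = 0..d. of_nat (mt l) * krawtchouk d N U m' (mi_sub mt (mi_unit l)))
      = of_nat (Suc N) * (\<Sum>a\<in>?M. krawtchouk_term d (Suc N) U m' mt a)" for m'
  proof -
    have "(\<Sum>l = 0..d. of_nat (mt l) * krawtchouk d N U m' (mi_sub mt (mi_unit l)))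
      = (\<Sum>a\<in>?M. \<Sum>l = 0..d. of_nat (mt l) * krawtchouk_term d N U m' (mi_sub mt (mi_unit l)) a)"
      unfolding krawtchouk_eq_sum_term sum_distrib_left by (rule sum.swap)
    also have "\<dots> = (\<Sum>a\<in>?M. of_nat (Suc N) * krawtchouk_term d (Suc N) U m' mt a)"
      by (rule sum.cong) (simp_all only: sum_krawtchouk_term_lower[OF mt])
    finally show ?thesis by (simp only: sum_distrib_left)
  qed
  show ?thesis
  proof (cases "i = 0")
    case True
    \<comment> \<open>Since m_0 > 0, matrices of total N + 1 contribute nothing.\<close>
    have "(\<Sum>a\<in>?M'. ?T a) = (\<Sum>a\<in>?M. ?T a)"
      using sub krawtchouk_term_eq_0[OF m] True mi
      by (intro sum.mono_neutral_right) (auto simp: finite_nat_matrices)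
    then have "of_nat (Suc N) * krawtchouk d (Suc N) U m mt
      = (\<Sum>l = 0..d. of_nat (mt l) * krawtchouk d N U m (mi_sub mt (mi_unit l)))"
      by (simp only: shift krawtchouk_eq_sum_term[of d "Suc N"])
    also have "\<dots> = (\<Sum>l = 0..d. of_nat (mt l) * U $$ (l, i) * ?K l)"
    proof (rule sum.cong)
      fix l assume "l \<in> {0..d}"
      then have "U $$ (l, i) = 1" using U True by simp
      moreover have "?K l = krawtchouk d N U m (mi_sub mt (mi_unit l))"
        using True by (intro krawtchouk_cong) (auto simp: mi_sub_def mi_unit_def)
      ultimately show "of_nat (mt l) * krawtchouk d N U m (mi_sub mt (mi_unit l))
        = of_nat (mt l) * U $$ (l, i) * ?K l" by simp
    qed simp
    finally show ?thesis .
  next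
    case False
    with i have i: "i \<in> {1..d}" by simp
    let ?c = "\<lambda>a. \<Sum>l = 1..d. a l i"
    have A: "of_nat (m i) * (\<Sum>l = 0..d. of_nat (mt l) * ?K l)
      = of_nat (Suc N) * (\<Sum>a\<in>?M'. (of_nat (m i) - of_nat (?c a)) * ?T a)"
    proof -
      have "(\<Sum>a\<in>?M'. (of_nat (m i) - of_nat (?c a)) * ?T a)
        = (\<Sum>a\<in>?M. (of_nat (m i) - of_nat (?c a)) * ?T a)"
      \<comment> \<open>At a matrix of total N + 1 either the factor m_i - c_i is zero, or the
        column sum differs from m_i and the term itself vanishes.\<close>
      proof (intro sum.mono_neutral_right ballI)
        fix a assume "a \<in> ?M' - ?M"
        then show "(of_nat (m i) - of_nat (?c a)) * ?T a = 0"
          using krawtchouk_term_eq_0[OF m, of a i] i by (cases "m i = ?c a") auto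
      qed (use sub finite_nat_matrices in auto)
      also have "\<dots> = of_nat (m i) * (\<Sum>a\<in>?M. krawtchouk_term d (Suc N) U (mi_sub m (mi_unit i)) mt a)"
        by (simp only: sum_distrib_left krawtchouk_term_sub_unit[OF i])
      finally show ?thesis by (simp only: shift mult.left_commute)
    qed
    have B: "of_nat (Suc N) * (\<Sum>a\<in>?M'. of_nat (a l i) * ?T a)
      = - (of_nat (m i) * (of_nat (mt l) * (1 - U $$ (l, i)) * ?K l))" if l: "l \<in> {1..d}" for l
      unfolding sum_nat_matrices_add_entry[OF l i] sum_distrib_left krawtchouk_term_add_entry[OF l i]
        krawtchouk_eq_sum_term sum_negf[symmetric]
      by (simp add: mult.assoc)
    have C: "of_nat (Suc N) * (\<Sum>a\<in>?M'. of_nat (?c a) * ?T a)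
      = - (of_nat (m i) * (\<Sum>l = 0..d. of_nat (mt l) * (1 - U $$ (l, i)) * ?K l))"
    proof -
      have "(\<Sum>a\<in>?M'. of_nat (?c a) * ?T a) = (\<Sum>l = 1..d. \<Sum>a\<in>?M'. of_nat (a l i) * ?T a)"
        unfolding of_nat_sum sum_distrib_right by (rule sum.swap)
      then have "of_nat (Suc N) * (\<Sum>a\<in>?M'. of_nat (?c a) * ?T a)
        = (\<Sum>l = 1..d. - (of_nat (m i) * (of_nat (mt l) * (1 - U $$ (l, i)) * ?K l)))"
        by (simp only: sum_distrib_left[of "of_nat (Suc N)" _ "{1..d}"] B cong: sum.cong)
      also have "\<dots> = - (of_nat (m i) * (\<Sum>l = 1..d. of_nat (mt l) * (1 - U $$ (l, i)) * ?K l))"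
        by (simp only: sum_negf sum_distrib_left)
      \<comment> \<open>The index l = 0 may be added because 1 - u_(0,i) = 0.\<close>
      also have "(\<Sum>l = 1..d. of_nat (mt l) * (1 - U $$ (l, i)) * ?K l)
        = (\<Sum>l = 0..d. of_nat (mt l) * (1 - U $$ (l, i)) * ?K l)"
        using U i by (simp add: sum.atLeast_Suc_atMost[of 0 d])
      finally show ?thesis .
    qed
    have "of_nat (m i) * (of_nat (Suc N) * krawtchouk d (Suc N) U m mt)
      = of_nat (Suc N) * ((\<Sum>a\<in>?M'. (of_nat (m i) - of_nat (?c a)) * ?T a)
          + (\<Sum>a\<in>?M'. of_nat (?c a) * ?T a))"
      unfolding krawtchouk_eq_sum_term sum.distrib[symmetric] distrib_right[symmetric]
        diff_add_cancel sum_distrib_left[of "of_nat (m i)", symmetric] by (simp only: mult.left_commute)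
    also have "\<dots> = of_nat (m i) * ((\<Sum>l = 0..d. of_nat (mt l) * ?K l)
        - (\<Sum>l = 0..d. of_nat (mt l) * (1 - U $$ (l, i)) * ?K l))"
      unfolding distrib_left A[symmetric] C by (simp add: right_diff_distrib)
    also have "\<dots> = of_nat (m i) * (\<Sum>l = 0..d. of_nat (mt l) * U $$ (l, i) * ?K l)"
      unfolding sum_subtractf[symmetric] by (simp add: algebra_simps)
    finally show ?thesis using mi by simp
  qed
qed

section \<open>Symmetry and orthogonality relations of the parameters\<close>

text \<open>Condition (iii) says that nu P U is a left inverse of the square matrix Pt U^t, hence
  also a right inverse. The product in the opposite order is condition (iii) for the transposed
  data.\<close>

lemma kappa_set_transpose:
  assumes "(\<nu>, P, Pt, U) \<in> kappa_set d"
  shows "(\<nu>, Pt, P, transpose_mat U) \<in> kappa_set d"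
proof -
  let ?n = "d + 1"
  have c: "P \<in> carrier_mat ?n ?n" "Pt \<in> carrier_mat ?n ?n" "U \<in> carrier_mat ?n ?n"
    and one: "\<nu> \<cdot>\<^sub>m (P * U * Pt * transpose_mat U) = 1\<^sub>m ?n"
    using assms by (auto simp: kappa_set_def)
  have "(\<nu> \<cdot>\<^sub>m (P * U)) * (Pt * transpose_mat U) = \<nu> \<cdot>\<^sub>m (P * U * (Pt * transpose_mat U))"
    using c by (intro mult_smult_assoc_mat[of _ ?n ?n _ ?n]) auto
  also have "P * U * (Pt * transpose_mat U) = P * U * Pt * transpose_mat U"
    using c by (intro assoc_mult_mat[symmetric, of _ ?n ?n _ ?n _ ?n]) auto
  also note one
  finally have "(Pt * transpose_mat U) * (\<nu> \<cdot>\<^sub>m (P * U)) = 1\<^sub>m ?n"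
    by (rule mat_mult_left_right_inverse[rotated 2]) (use c in auto)
  moreover have "(Pt * transpose_mat U) * (\<nu> \<cdot>\<^sub>m (P * U))
      = \<nu> \<cdot>\<^sub>m (Pt * transpose_mat U * (P * U))"
    using c by (intro mult_smult_distrib[of _ ?n ?n _ ?n]) auto
  moreover have "Pt * transpose_mat U * (P * U) = Pt * transpose_mat U * P * U"
    using c by (intro assoc_mult_mat[symmetric, of _ ?n ?n _ ?n _ ?n]) auto
  ultimately have "\<nu> \<cdot>\<^sub>m (Pt * transpose_mat U * P * U) = 1\<^sub>m ?n"
    by simp
  then show ?thesis
    using assms by (auto simp: kappa_set_def)
qed

lemma kappa_set_entries:
  assumes K: "(\<nu>, P, Pt, U) \<in> kappa_set d" and i: "i \<le> d" and j: "j \<le> d"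
  shows "(\<Sum>k = 0..d. \<nu> * P $$ (i, i) * Pt $$ (k, k) * U $$ (i, k) * U $$ (j, k))
    = (if i = j then 1 else 0)"
proof -
  let ?n = "d + 1"
  have c: "P \<in> carrier_mat ?n ?n" "Pt \<in> carrier_mat ?n ?n" "U \<in> carrier_mat ?n ?n"
    and D: "diagonal_mat P" "diagonal_mat Pt"
    and one: "\<nu> \<cdot>\<^sub>m (P * U * Pt * transpose_mat U) = 1\<^sub>m ?n"
    using K by (auto simp: kappa_set_def)
  have entry: "(A * B) $$ (r, k) = (\<Sum>l = 0..<?n. A $$ (r, l) * B $$ (l, k))"
    if "A \<in> carrier_mat ?n ?n" "B \<in> carrier_mat ?n ?n" "r \<le> d" "k \<le> d"
    for A B :: "complex mat" and r k
    using that by (simp add: scalar_prod_def)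
  have PU: "(P * U) $$ (i, k) = P $$ (i, i) * U $$ (i, k)" if "k \<le> d" for k
  proof -
    have "(P * U) $$ (i, k) = (\<Sum>l = 0..<?n. P $$ (i, l) * U $$ (l, k))"
      using c i that by (intro entry) auto
    also have "\<dots> = (\<Sum>l\<in>{i}. P $$ (i, l) * U $$ (l, k))"
      using D(1) c i by (intro sum.mono_neutral_right) (auto simp: diagonal_mat_def)
    finally show ?thesis by simp
  qed
  have PUP: "(P * U * Pt) $$ (i, k) = P $$ (i, i) * U $$ (i, k) * Pt $$ (k, k)" if "k \<le> d" for k
  proof -
    have "(P * U * Pt) $$ (i, k) = (\<Sum>l = 0..<?n. (P * U) $$ (i, l) * Pt $$ (l, k))"
      using c i that by (intro entry) auto
    also have "\<dots> = (\<Sum>l\<in>{k}. (P * U) $$ (i, l) * Pt $$ (l, k))"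
      using D(2) c that by (intro sum.mono_neutral_right) (auto simp: diagonal_mat_def)
    finally show ?thesis using PU[OF that] by simp
  qed
  have "(\<nu> \<cdot>\<^sub>m (P * U * Pt * transpose_mat U)) $$ (i, j)
    = \<nu> * (\<Sum>k = 0..<?n. (P * U * Pt) $$ (i, k) * U $$ (j, k))"
    using c i j by (subst index_smult_mat, simp, simp, subst entry) (auto intro!: sum.cong)
  also have "\<dots> = (\<Sum>k = 0..d. \<nu> * P $$ (i, i) * Pt $$ (k, k) * U $$ (i, k) * U $$ (j, k))"
    unfolding sum_distrib_left by (intro sum.cong) (auto simp: PUP)
  finally show ?thesis
    using i j unfolding one by simp
qed

section \<open>The identity in homogeneous form\<close>

text \<open>Lowering mt + v_k - v_l at k leaves mt - v_l, which no longer depends on k. After the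
  transposed recursion the sum over k therefore involves only the parameters, and V U = I selects
  the index i.\<close>

lemma krawtchouk_bispectral_homogeneous:
  assumes K: "(\<nu>, P, Pt, U) \<in> kappa_set d"
    and m: "(\<Sum>j = 0..d. m j) = Suc N" and mt: "(\<Sum>j = 0..d. mt j) = Suc N"
    and i: "i \<le> d"
  shows "of_nat (m i) * krawtchouk d (Suc N) U m mt
    = (\<Sum>k = 0..d. \<Sum>l = 0..d. \<nu> * Pt $$ (i, i) * P $$ (k, k) * U $$ (k, i) * U $$ (l, i)
        * of_nat (mt l) * krawtchouk d (Suc N) U m (mi_sub (mi_add mt (mi_unit k)) (mi_unit l)))"
proof -
  let ?V = "\<lambda>k. \<nu> * Pt $$ (i, i) * P $$ (k, k) * U $$ (k, i)"
  let ?S = "\<lambda>k l. mi_sub (mi_add mt (mi_unit k)) (mi_unit l)"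
  let ?L = "\<lambda>j l. krawtchouk d N U (mi_sub m (mi_unit j)) (mi_sub mt (mi_unit l))"
  have c: "U \<in> carrier_mat (d + 1) (d + 1)" and U: "\<forall>j\<le>d. U $$ (0, j) = 1 \<and> U $$ (j, 0) = 1"
    using K by (auto simp: kappa_set_def)
  have U': "\<forall>j\<le>d. transpose_mat U $$ (0, j) = 1 \<and> transpose_mat U $$ (j, 0) = 1"
    using U c by auto
  have orth: "(\<Sum>k = 0..d. ?V k * U $$ (k, j)) = (if i = j then 1 else 0)" if j: "j \<le> d" for j
  proof -
    have "(\<Sum>k = 0..d. ?V k * U $$ (k, j)) = (\<Sum>k = 0..d. \<nu> * Pt $$ (i, i) * P $$ (k, k)
        * transpose_mat U $$ (i, k) * transpose_mat U $$ (j, k))"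
      using c i j by (intro sum.cong) auto
    also have "\<dots> = (if i = j then 1 else 0)"
      by (rule kappa_set_entries[OF kappa_set_transpose[OF K] i j])
    finally show ?thesis .
  qed
  have rec: "of_nat (Suc N) * krawtchouk d (Suc N) U m (?S k l)
    = (\<Sum>j = 0..d. of_nat (m j) * U $$ (k, j) * ?L j l)"
    if k: "k \<le> d" and l: "l \<le> d" and pos: "mt l > 0" for k l
  proof -
    have sum: "(\<Sum>j = 0..d. ?S k l j) = Suc N"
    proof -
      have "?S k l j + mi_unit l j = mt j + mi_unit k j" for j
        using pos by (auto simp: mi_sub_def mi_add_def mi_unit_def)
      then have "(\<Sum>j = 0..d. ?S k l j) + (\<Sum>j = 0..d. mi_unit l j)
        = (\<Sum>j = 0..d. mt j) + (\<Sum>j = 0..d. mi_unit k j)"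
        by (simp only: sum.distrib[symmetric])
      then show ?thesis using k l mt by (simp add: mi_unit_def)
    qed
    \<comment> \<open>This is the positivity that the recursion requires at k. It also holds for k =
      l, where the multi-index is mt itself and mt_l > 0.\<close>
    have pos': "?S k l k > 0"
      using pos by (auto simp: mi_sub_def mi_add_def mi_unit_def)
    have S_minus: "mi_sub (?S k l) (mi_unit k) = mi_sub mt (mi_unit l)"
      by (auto simp: mi_sub_def mi_add_def mi_unit_def fun_eq_iff)
    have "of_nat (Suc N) * krawtchouk d (Suc N) U m (?S k l)
      = (\<Sum>j = 0..d. of_nat (m j) * transpose_mat U $$ (j, k)
          * krawtchouk d N (transpose_mat U) (mi_sub mt (mi_unit l)) (mi_sub m (mi_unit j)))"
      using krawtchouk_rec[OF sum m U' k pos'] unfolding krawtchouk_transpose[OF c] S_minus .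
    also have "\<dots> = (\<Sum>j = 0..d. of_nat (m j) * U $$ (k, j) * ?L j l)"
      unfolding krawtchouk_transpose[OF c] using c k by (intro sum.cong) auto
    finally show ?thesis .
  qed
  \<comment> \<open>The factor mt_l is kept on both sides: when it is 0 the truncated mt - v_l is
    meaningless and both sides vanish.\<close>
  have inner: "of_nat (mt l) * (of_nat (Suc N) * (\<Sum>k = 0..d. ?V k * krawtchouk d (Suc N) U m (?S k l)))
    = of_nat (mt l) * (of_nat (m i) * ?L i l)" if l: "l \<le> d" for l
  proof (cases "mt l = 0")
    case False
    have "of_nat (Suc N) * (\<Sum>k = 0..d. ?V k * krawtchouk d (Suc N) U m (?S k l))
      = (\<Sum>k = 0..d. ?V k * (of_nat (Suc N) * krawtchouk d (Suc N) U m (?S k l)))"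
      by (simp only: sum_distrib_left mult.left_commute)
    also have "\<dots> = (\<Sum>k = 0..d. ?V k * (\<Sum>j = 0..d. of_nat (m j) * U $$ (k, j) * ?L j l))"
      using rec l False by (intro sum.cong) (simp_all del: of_nat_Suc)
    also have "\<dots> = (\<Sum>k = 0..d. \<Sum>j = 0..d. (?V k * U $$ (k, j)) * (of_nat (m j) * ?L j l))"
      by (simp add: sum_distrib_left mult_ac)
    also have "\<dots> = (\<Sum>j = 0..d. (\<Sum>k = 0..d. ?V k * U $$ (k, j)) * (of_nat (m j) * ?L j l))"
      unfolding sum_distrib_right by (rule sum.swap)
    also have "\<dots> = (\<Sum>j = 0..d. if i = j then of_nat (m j) * ?L j l else 0)"
      using orth by (intro sum.cong) auto
    also have "\<dots> = of_nat (m i) * ?L i l" using i by simp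
    finally show ?thesis by simp
  qed simp
  have "of_nat (Suc N) * (\<Sum>k = 0..d. \<Sum>l = 0..d. ?V k * U $$ (l, i)
        * of_nat (mt l) * krawtchouk d (Suc N) U m (?S k l))
    = of_nat (Suc N) * (\<Sum>l = 0..d. \<Sum>k = 0..d. ?V k * U $$ (l, i)
        * of_nat (mt l) * krawtchouk d (Suc N) U m (?S k l))"
    by (subst sum.swap) (rule refl)
  also have "\<dots> = (\<Sum>l = 0..d. U $$ (l, i) * (of_nat (mt l)
      * (of_nat (Suc N) * (\<Sum>k = 0..d. ?V k * krawtchouk d (Suc N) U m (?S k l)))))"
    by (simp only: sum_distrib_left mult_ac)
  also have "\<dots> = (\<Sum>l = 0..d. U $$ (l, i) * (of_nat (mt l) * (of_nat (m i) * ?L i l)))"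
    by (intro sum.cong) (simp_all only: inner atLeastAtMost_iff)
  also have "\<dots> = of_nat (m i) * (\<Sum>l = 0..d. of_nat (mt l) * U $$ (l, i) * ?L i l)"
    by (simp only: sum_distrib_left mult_ac)
  \<comment> \<open>The recursion needs m_i > 0; otherwise both sides are 0.\<close>
  also have "\<dots> = of_nat (m i) * (of_nat (Suc N) * krawtchouk d (Suc N) U m mt)"
    using krawtchouk_rec[OF m mt U i] by (cases "m i = 0") simp_all
  finally show ?thesis
    using of_nat_neq_0[of N, where 'a = complex]
    by (simp only: mult.left_commute[of "of_nat (m i)"] mult_cancel_left) simp
qed

section \<open>Return to d variables\<close>

text \<open>With the slack placed in entry 0, the homogeneous double sum splits into the pairs
  (0,0), (0,l), (k,0), (k,k) and k different from l. The pairs (0,l) and (k,0) give the first two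
  sums and the unequal pairs the last; (0,0) and (k,k) combine into the centred diagonal
  sum.\<close>

lemma krawtchouk_bispectral:
  assumes N: "N \<ge> 1" and K: "(\<nu>, P, Pt, U) \<in> kappa_set d"
    and m: "mi_size d m \<le> N" and mt: "mi_size d mt \<le> N" and i: "i \<in> {1..d}"
  shows
    "(of_nat (m i) - of_nat N / of_nat (d + 1)) * krawtchouk d N U m mt =
       (\<Sum>l = 1..d. Pt $$ (i, i) * U $$ (l, i) * of_nat (mt l)
          * krawtchouk d N U m (mi_sub mt (mi_unit l)))
     + \<nu> * (\<Sum>k = 1..d. Pt $$ (i, i) * P $$ (k, k) * U $$ (k, i)
          * (of_nat N - of_nat (mi_size d mt))
          * krawtchouk d N U m (mi_add mt (mi_unit k)))
     + (\<Sum>j = 1..d. Pt $$ (i, i) * (\<nu> * P $$ (j, j) * (U $$ (j, i))\<^sup>2 - 1)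
          * (of_nat (mt j) - of_nat N / of_nat (d + 1)) * krawtchouk d N U m mt)
     + \<nu> * (\<Sum>k = 1..d. \<Sum>l\<in>{1..d} - {k}.
          Pt $$ (i, i) * P $$ (k, k) * U $$ (k, i) * U $$ (l, i) * of_nat (mt l)
          * krawtchouk d N U m (mi_sub (mi_add mt (mi_unit k)) (mi_unit l)))"
proof -
  obtain n where n: "N = Suc n" using N by (cases N) auto
  define M where "M = m(0 := N - mi_size d m)"
  define Mt where "Mt = mt(0 := N - mi_size d mt)"
  let ?C = "krawtchouk d N U m"
  let ?S = "\<lambda>k l. mi_sub (mi_add mt (mi_unit k)) (mi_unit l)"
  let ?p = "Pt $$ (i, i)"
  define c :: complex where "c = of_nat N / of_nat (d + 1)"
  define q where "q k = \<nu> * P $$ (k, k) * U $$ (k, i)" for k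
  define G where "G k l = ?p * q k * U $$ (l, i) * of_nat (Mt l) * ?C (?S k l)" for k l
  have U: "U \<in> carrier_mat (d + 1) (d + 1)" "\<forall>j\<le>d. U $$ (0, j) = 1 \<and> U $$ (j, 0) = 1"
    and \<nu>: "\<nu> \<noteq> 0" "P $$ (0, 0) = 1 / \<nu>"
    using K by (auto simp: kappa_set_def)
  have q0: "q 0 = 1" and U0: "U $$ (0, i) = 1" using U \<nu> i by (auto simp: q_def)
  have split: "(\<Sum>k = 0..d. f k) = f 0 + (\<Sum>k = 1..d. f k)" for f :: "nat \<Rightarrow> 'b :: comm_monoid_add"
    by (simp add: sum.atLeast_Suc_atMost[of 0 d])
  have sums: "(\<Sum>j = 0..d. M j) = Suc n" "(\<Sum>j = 0..d. Mt j) = Suc n"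
    using m mt by (simp_all add: split M_def Mt_def n mi_size_def)
  have Mt0: "of_nat (Mt 0) = of_nat N - (of_nat (mi_size d mt) :: complex)"
    using mt by (simp add: Mt_def of_nat_diff)
  have Mtl: "Mt l = mt l" if "l \<in> {1..d}" for l using that by (simp add: Mt_def)
  have "of_nat (m i) * ?C mt = of_nat (M i) * krawtchouk d (Suc n) U M Mt"
    using i unfolding n by (intro arg_cong2[where f = "(*)"] krawtchouk_cong) (auto simp: M_def Mt_def)
  also have "\<dots> = (\<Sum>k = 0..d. \<Sum>l = 0..d. \<nu> * ?p * P $$ (k, k) * U $$ (k, i) * U $$ (l, i)
        * of_nat (Mt l) * krawtchouk d (Suc n) U M (mi_sub (mi_add Mt (mi_unit k)) (mi_unit l)))"
    using i by (intro krawtchouk_bispectral_homogeneous[OF K sums]) auto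
  also have "\<dots> = (\<Sum>k = 0..d. \<Sum>l = 0..d. G k l)"
  proof (intro sum.cong refl)
    fix k l
    have "krawtchouk d (Suc n) U M (mi_sub (mi_add Mt (mi_unit k)) (mi_unit l)) = ?C (?S k l)"
      unfolding n by (intro krawtchouk_cong) (auto simp: M_def Mt_def mi_sub_def mi_add_def)
    then show "\<nu> * ?p * P $$ (k, k) * U $$ (k, i) * U $$ (l, i)
        * of_nat (Mt l) * krawtchouk d (Suc n) U M (mi_sub (mi_add Mt (mi_unit k)) (mi_unit l)) = G k l"
      by (simp add: G_def q_def)
  qed
  also have "\<dots> = G 0 0 + (\<Sum>l = 1..d. G 0 l) + (\<Sum>k = 1..d. G k 0)
      + (\<Sum>k = 1..d. \<Sum>l = 1..d. G k l)"
    by (simp add: split sum.distrib)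
  also have "(\<Sum>k = 1..d. \<Sum>l = 1..d. G k l)
    = (\<Sum>k = 1..d. G k k) + (\<Sum>k = 1..d. \<Sum>l\<in>{1..d} - {k}. G k l)"
    unfolding sum.distrib[symmetric] by (intro sum.cong) (auto intro: sum.remove)
  finally have main: "of_nat (m i) * ?C mt = G 0 0 + (\<Sum>l = 1..d. G 0 l) + (\<Sum>k = 1..d. G k 0)
      + ((\<Sum>k = 1..d. G k k) + (\<Sum>k = 1..d. \<Sum>l\<in>{1..d} - {k}. G k l))" .
  have lower: "(\<Sum>l = 1..d. G 0 l) = (\<Sum>l = 1..d. ?p * U $$ (l, i) * of_nat (mt l)
      * ?C (mi_sub mt (mi_unit l)))"
  proof (intro sum.cong refl)
    fix l assume l: "l \<in> {1..d}"
    have "?C (?S 0 l) = ?C (mi_sub mt (mi_unit l))"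
      by (intro krawtchouk_cong) (auto simp: mi_sub_def mi_add_def mi_unit_def)
    then show "G 0 l = ?p * U $$ (l, i) * of_nat (mt l) * ?C (mi_sub mt (mi_unit l))"
      using Mtl[OF l] by (simp add: G_def q0)
  qed
  have upper: "(\<Sum>k = 1..d. G k 0) = \<nu> * (\<Sum>k = 1..d. ?p * P $$ (k, k) * U $$ (k, i)
      * (of_nat N - of_nat (mi_size d mt)) * ?C (mi_add mt (mi_unit k)))"
    unfolding sum_distrib_left
  proof (intro sum.cong refl)
    fix k
    have "?C (?S k 0) = ?C (mi_add mt (mi_unit k))"
      by (intro krawtchouk_cong) (auto simp: mi_sub_def mi_add_def mi_unit_def)
    then show "G k 0 = \<nu> * (?p * P $$ (k, k) * U $$ (k, i)
      * (of_nat N - of_nat (mi_size d mt)) * ?C (mi_add mt (mi_unit k)))"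
      by (simp add: G_def q_def U0 Mt0)
  qed
  have off: "(\<Sum>k = 1..d. \<Sum>l\<in>{1..d} - {k}. G k l) = \<nu> * (\<Sum>k = 1..d. \<Sum>l\<in>{1..d} - {k}.
      ?p * P $$ (k, k) * U $$ (k, i) * U $$ (l, i) * of_nat (mt l) * ?C (?S k l))"
    unfolding sum_distrib_left by (intro sum.cong refl) (simp add: G_def q_def Mtl)
  have S: "?S k k = mt" for k
    by (auto simp: mi_sub_def mi_add_def)
  \<comment> \<open>This is the (i,i) entry of V U = I with its k = 0 summand, which equals pt_i,
    moved to the other side.\<close>
  have orth: "?p * (\<Sum>j = 1..d. q j * U $$ (j, i)) = 1 - ?p"
  proof -
    have "(\<Sum>k = 0..d. ?p * (q k * U $$ (k, i)))
      = (\<Sum>k = 0..d. \<nu> * ?p * P $$ (k, k) * transpose_mat U $$ (i, k) * transpose_mat U $$ (i, k))"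
      using U(1) i by (intro sum.cong) (auto simp: q_def)
    also have "\<dots> = 1"
      using kappa_set_entries[OF kappa_set_transpose[OF K], of i i] i by simp
    finally show ?thesis by (simp add: split q0 U0 sum_distrib_left algebra_simps)
  qed
  \<comment> \<open>With c = N/(d+1), the constants add up to d c pt_i - c (1 - pt_i) = N pt_i - c.
    Here N pt_i joins -pt_i |mt| to form the (0,0) term, and -c is the shift on the left-hand side.
    This explains the choice of centre.\<close>
  have "(\<Sum>j = 1..d. ?p * (\<nu> * P $$ (j, j) * (U $$ (j, i))\<^sup>2 - 1) * (of_nat (mt j) - c) * ?C mt)
    = (\<Sum>j = 1..d. G j j + c * ?C mt * ?p - ?C mt * ?p * of_nat (mt j)
        - c * ?C mt * (?p * (q j * U $$ (j, i))))"
    by (intro sum.cong refl) (simp add: G_def q_def S Mtl power2_eq_square algebra_simps)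
  also have "\<dots> = (\<Sum>j = 1..d. G j j) + of_nat d * (c * ?C mt * ?p)
      - ?C mt * ?p * of_nat (mi_size d mt) - c * ?C mt * (1 - ?p)"
    by (simp only: sum.distrib sum_subtractf sum_distrib_left[symmetric] orth)
      (simp add: mi_size_def algebra_simps)
  also have "\<dots> = (\<Sum>j = 1..d. G j j) + (of_nat (d + 1) * c) * ?C mt * ?p
      - ?C mt * ?p * of_nat (mi_size d mt) - c * ?C mt"
    by (simp add: algebra_simps)
  also have "of_nat (d + 1) * c = of_nat N"
    unfolding c_def using of_nat_neq_0[of d, where 'a = complex] by simp
  also have "(\<Sum>j = 1..d. G j j) + of_nat N * ?C mt * ?p
      - ?C mt * ?p * of_nat (mi_size d mt) - c * ?C mt = (\<Sum>j = 1..d. G j j) + G 0 0 - c * ?C mt"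
    by (simp add: G_def q0 U0 S Mt0 algebra_simps)
  finally have diag: "(\<Sum>j = 1..d. ?p * (\<nu> * P $$ (j, j) * (U $$ (j, i))\<^sup>2 - 1)
      * (of_nat (mt j) - c) * ?C mt) = (\<Sum>j = 1..d. G j j) + G 0 0 - c * ?C mt" .
  show ?thesis
    unfolding c_def[symmetric] diag lower[symmetric] upper[symmetric] off[symmetric] left_diff_distrib main
    by (simp add: algebra_simps)
qed

theorem theorem6p1:
  fixes d N i :: nat
    and \<nu> :: complex
    and P Pt U :: "complex mat"
    and m mt :: "nat \<Rightarrow> nat"
  assumes "d \<ge> 1" and "N \<ge> 1"
    and "(\<nu>, P, Pt, U) \<in> kappa_set d"
    and "mi_size d m \<le> N" and "mi_size d mt \<le> N"
    and "i \<in> {1..d}"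
  shows
    "(of_nat (m i) - of_nat N / of_nat (d + 1)) * krawtchouk d N U m mt =
       (\<Sum>l = 1..d. Pt $$ (i, i) * U $$ (l, i) * of_nat (mt l)
          * krawtchouk d N U m (mi_sub mt (mi_unit l)))
     + \<nu> * (\<Sum>k = 1..d. Pt $$ (i, i) * P $$ (k, k) * U $$ (k, i)
          * (of_nat N - of_nat (mi_size d mt))
          * krawtchouk d N U m (mi_add mt (mi_unit k)))
     + (\<Sum>j = 1..d. Pt $$ (i, i) * (\<nu> * P $$ (j, j) * (U $$ (j, i))\<^sup>2 - 1)
          * (of_nat (mt j) - of_nat N / of_nat (d + 1)) * krawtchouk d N U m mt)
     + \<nu> * (\<Sum>k = 1..d. \<Sum>l\<in>{1..d} - {k}.
          Pt $$ (i, i) * P $$ (k, k) * U $$ (k, i) * U $$ (l, i) * of_nat (mt l)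
          * krawtchouk d N U m (mi_sub (mi_add mt (mi_unit k)) (mi_unit l)))
     \<and>
     (of_nat (mt i) - of_nat N / of_nat (d + 1)) * krawtchouk d N U m mt =
       (\<Sum>l = 1..d. P $$ (i, i) * U $$ (i, l) * of_nat (m l)
          * krawtchouk d N U (mi_sub m (mi_unit l)) mt)
     + \<nu> * (\<Sum>k = 1..d. P $$ (i, i) * Pt $$ (k, k) * U $$ (i, k)
          * (of_nat N - of_nat (mi_size d m))
          * krawtchouk d N U (mi_add m (mi_unit k)) mt)
     + (\<Sum>j = 1..d. P $$ (i, i) * (\<nu> * Pt $$ (j, j) * (U $$ (i, j))\<^sup>2 - 1)
          * (of_nat (m j) - of_nat N / of_nat (d + 1)) * krawtchouk d N U m mt)
     + \<nu> * (\<Sum>k = 1..d. \<Sum>l\<in>{1..d} - {k}.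
          P $$ (i, i) * Pt $$ (k, k) * U $$ (i, k) * U $$ (i, l) * of_nat (m l)
          * krawtchouk d N U (mi_sub (mi_add m (mi_unit k)) (mi_unit l)) mt)"
proof (rule conjI, goal_cases)
  case 1
  show ?case using assms by (intro krawtchouk_bispectral) auto
next
  case 2
  have K: "(\<nu>, P, Pt, U) \<in> kappa_set d" by fact
  then have U: "U \<in> carrier_mat (d + 1) (d + 1)" by (simp add: kappa_set_def)
  have tr: "transpose_mat U $$ (k, l) = U $$ (l, k)" if "k \<in> {1..d}" "l \<in> {1..d}" for k l
    using U that by auto
  show ?case
    \<comment> \<open>Transposed data exchange the roles of m and mt, so the two size bounds are
      supplied in reverse order.\<close>
    using krawtchouk_bispectral[OF \<open>N \<ge> 1\<close> kappa_set_transpose[OF K] assms(5,4,6)] assms(6)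
    unfolding krawtchouk_transpose[OF U] by (simp add: tr)
qed

end
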